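(* Let $\gamma=1$ and let $\alpha,\beta\in[0,1]$ with $\alpha,\beta\ne1$ and $\alpha+\beta>1$. Let $X_j^n$ be the forest-fire random field with parameters $\alpha,\beta,\gamma$, and let $Y_n=\sum_{j=0}^n X_j^n$ for $n\ge0$. Then $$\lim_{n\to\infty}\mathbb{P}\{Y_n=0\}\ \ge\ \frac{(1-\alpha)(1-\beta)}{\alpha\beta}.$$
   Context: Forest-fire random field with parameters $\alpha,\beta,\gamma$, where $0\le\alpha,\beta\le\gamma\le1$: $\mathbb{N}=\{0,1,2,\ldots\}$. A family of $\{0,1\}$-valued random variables $X(j,k)$, $j,k\in\mathbb{N}$, is given on a probability space; write $X_j^n=X(j,n-j)$ for $0\le j\le n$. Boundary conditions: $X(0,0)=1$ and $X(j,-1)=X(-1,k)=0$ for all $j,k\in\mathbb{N}$, i.e. $X_0^0=1$ and $X_{-1}^n=X_{n+1}^n=0$ for all $n\ge0$. Let $\mathcal{F}_n=\sigma(X_j^m:\ 0\le j\le m\le n)$. The law of the field is defined inductively: for every $n\ge0$, given $\mathcal{F}_n$, the variables $X_0^{n+1},\ldots,X_{n+1}^{n+1}$ are conditionally independent, and for each $0\le j\le n+1$ the conditional law of $X_j^{n+1}$ given $\mathcal{F}_n$ depends only on $(X_{j-1}^n,X_j^n)$: the conditional probability that $X_j^{n+1}=1$ equals $0$ if $(X_{j-1}^n,X_j^n)=(0,0)$, equals $\alpha$ if it is $(1,0)$, equals $\beta$ if it is $(0,1)$, and equals $\gamma$ if it is $(1,1)$. Up to null sets $\{Y_n=0\}\subset\{Y_{n+1}=0\}$,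 so $\mathbb{P}\{Y_n=0\}$ is nondecreasing in $n$ and its limit exists. *)

theory Defs
  imports "HOL-Probability.Probability"
begin

abbreviation cond_prob_alg :: "'w measure \<Rightarrow> 'w measure \<Rightarrow> 'w set \<Rightarrow> 'w \<Rightarrow> real" where
  "cond_prob_alg M F A \<equiv> real_cond_exp M F (indicator A)"

(* The conditional counterpart of indep_vars. *)
definition cond_indep_vars ::
    "'w measure \<Rightarrow> 'w measure \<Rightarrow> ('i \<Rightarrow> 'b measure) \<Rightarrow> ('i \<Rightarrow> 'w \<Rightarrow> 'b) \<Rightarrow> 'i set \<Rightarrow> bool" where
  "cond_indep_vars M F M' Z I \<longleftrightarrow>
     (\<forall>i\<in>I. Z i \<in> measurable M (M' i)) \<and>
     (\<forall>J\<subseteq>I. J \<noteq> {} \<longrightarrow> finite J \<longrightarrow> (\<forall>A. (\<forall>j\<in>J. A j \<in> sets (M' j)) \<longrightarrow>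
        (AE w in M. cond_prob_alg M F (\<Inter>j\<in>J. Z j -` A j \<inter> space M) w
                  = (\<Prod>j\<in>J. cond_prob_alg M F (Z j -` A j \<inter> space M) w))))"

(* site X n j is X_j^n = X(j, n - j). The index j is an integer so that the boundary
   values X(-1, k) = X(j, -1) = 0, that is X_{-1}^n = X_{n+1}^n = 0, can be expressed. *)
definition site :: "(nat \<Rightarrow> nat \<Rightarrow> 'w \<Rightarrow> nat) \<Rightarrow> nat \<Rightarrow> int \<Rightarrow> 'w \<Rightarrow> nat" where
  "site X n j w = (if 0 \<le> j \<and> j \<le> int n then X (nat j) (n - nat j) w else 0)"

definition history :: "'w measure \<Rightarrow> (nat \<Rightarrow> nat \<Rightarrow> 'w \<Rightarrow> nat) \<Rightarrow> nat \<Rightarrow> 'w measure" where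
  "history M X n = sigma (space M)
     {site X m j -` A \<inter> space M | m j A. m \<le> n \<and> 0 \<le> j \<and> j \<le> int m}"

(* Conditional probability that X_j^{n+1} = 1, given (X_{j-1}^n, X_j^n) = (a, b). *)
definition fire_prob :: "real \<Rightarrow> real \<Rightarrow> real \<Rightarrow> nat \<Rightarrow> nat \<Rightarrow> real" where
  "fire_prob \<alpha> \<beta> \<gamma> a b =
     (if (a, b) = (1, 0) then \<alpha> else if (a, b) = (0, 1) then \<beta>
      else if (a, b) = (1, 1) then \<gamma> else 0)"

locale forest_fire = prob_space M
  for M :: "'w measure" and X :: "nat \<Rightarrow> nat \<Rightarrow> 'w \<Rightarrow> nat" and \<alpha> \<beta> \<gamma> :: real +
  assumes parameters: "0 \<le> \<alpha>" "\<alpha> \<le> \<gamma>" "0 \<le> \<beta>" "\<beta> \<le> \<gamma>" "\<gamma> \<le> 1"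
    and measurable_X: "\<And>j k. X j k \<in> measurable M (count_space UNIV)"
    and range_X: "\<And>j k w. w \<in> space M \<Longrightarrow> X j k w \<in> {0, 1}"
    and origin: "\<And>w. w \<in> space M \<Longrightarrow> X 0 0 w = 1"
    and cond_indep: "\<And>n. cond_indep_vars M (history M X n)
          (\<lambda>_. count_space UNIV) (site X (n + 1)) {0..int n + 1}"
    and cond_law: "\<And>n j. 0 \<le> j \<Longrightarrow> j \<le> int n + 1 \<Longrightarrow>
          (AE w in M. cond_prob_alg M (history M X n) {w' \<in> space M. site X (n + 1) j w' = 1} w
                    = fire_prob \<alpha> \<beta> \<gamma> (site X n (j - 1) w) (site X n j w))"
begin

lemma measurable_site: "site X n j \<in> measurable M (count_space UNIV)"
  unfolding site_def using measurable_X by (cases "0 \<le> j \<and> j \<le> int n") simp_all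

(* real_cond_exp is a genuine conditional expectation only for a sub-sigma-algebra. *)
lemma subalgebra_history: "subalgebra M (history M X n)"
proof -
  have "{site X m j -` A \<inter> space M | m j A. m \<le> n \<and> 0 \<le> j \<and> j \<le> int m} \<subseteq> sets M"
    using measurable_site by (auto intro: measurable_sets)
  then show ?thesis
    unfolding subalgebra_def history_def
    by (subst sets_measure_of) (auto intro!: sets.sigma_sets_subset simp: space_measure_of_conv)
qed

end

definition row_sum :: "(nat \<Rightarrow> nat \<Rightarrow> 'w \<Rightarrow> nat) \<Rightarrow> nat \<Rightarrow> 'w \<Rightarrow> nat" where
  "row_sum X n w = (\<Sum>j=0..n. site X n (int j) w)"

end

theory Submission
  imports Defs
begin

text \<open>
  When \<open>\<gamma> = 1\<close> the sites on fire in row \<open>n\<close> always form an interval \<open>{a..<b}\<close>, since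
  only \<open>X\<^sub>a\<close> and \<open>X\<^sub>b\<close> in the next row are random; so \<open>Y\<^sub>n\<close> is a lazy random walk absorbed at 0, with
  up-probability \<open>\<alpha>\<beta>\<close> and down-probability \<open>(1 - \<alpha>)(1 - \<beta>)\<close>. On \<open>{Y\<^sub>n > 0}\<close> one step
  multiplies the expectation of \<open>r ^ Y\<^sub>n\<close> by \<open>\<phi> r = (1 - \<alpha> + \<alpha>r)(1 - \<beta> + \<beta>r) / r\<close>.
  For \<open>\<rho> = (1 - \<alpha>)(1 - \<beta>) / (\<alpha>\<beta>) < 1\<close> we have \<open>\<phi> \<rho> = 1\<close>, which makes \<open>\<rho> ^ Y\<^sub>n\<close> a martingale, whereas
  \<open>\<phi> (sqrt \<rho>) < 1\<close>, and since \<open>\<rho> < sqrt \<rho>\<close> the contribution of \<open>{Y\<^sub>n > 0}\<close>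
  to the expectation of \<open>\<rho> ^ Y\<^sub>n\<close> vanishes in the limit.
  Hence the extinction probability is in fact equal to \<open>\<rho>\<close>.
\<close>

context forest_fire
begin

text \<open>The half-open form lets one event cover both situations: for \<open>b \<le> a\<close>
  the interval is empty and \<open>cluster n a b\<close> says that row \<open>n\<close> has died
  out, whatever \<open>a\<close> and \<open>b\<close> are. The integer \<open>j\<close> also ranges
  over positions beyond the row, where \<open>site\<close> is 0; this is what later confines the
  endpoints.\<close>

definition cluster :: "nat \<Rightarrow> int \<Rightarrow> int \<Rightarrow> 'w set" where
  "cluster n a b = {w \<in> space M. \<forall>j. site X n j w = indicator {a..<b} j}"

section \<open>Measurability with respect to the history\<close>

lemma space_history [simp]: "space (history M X n) = space M"
  using subalgebra_history[of n] by (simp add: subalgebra_def)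

lemma site_outside: "j < 0 \<or> int n < j \<Longrightarrow> site X n j w = 0"
  by (auto simp: site_def)

lemma site_range: "w \<in> space M \<Longrightarrow> site X n j w = 0 \<or> site X n j w = 1"
  using range_X by (auto simp: site_def)

text \<open>Positions within the row are generators of \<open>history M X n\<close>; the boundary
  positions are constantly 0, hence measurable as well. Covering both avoids case distinctions at
  the ends of a row.\<close>

lemma site_history: "site X n j \<in> measurable (history M X n) (count_space UNIV)"
proof (cases "0 \<le> j \<and> j \<le> int n")
  case True
  show ?thesis
  proof (rule measurableI)
    fix A :: "nat set"
    have "site X n j -` A \<inter> space M \<in>
        {site X m j -` A \<inter> space M | m j A. m \<le> n \<and> 0 \<le> j \<and> j \<le> int m}"
      using True by blast
    then show "site X n j -` A \<inter> space (history M X n) \<in> sets (history M X n)"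
      unfolding space_history by (auto simp: history_def intro!: sigma_sets.Basic)
  qed simp
next
  case False
  then have "site X n j = (\<lambda>w. 0)"
    by (auto simp: site_def)
  then show ?thesis by simp
qed

lemma sets_history_sites:
  "{w \<in> space M. P (site X n i w) (site X n j w)} \<in> sets (history M X n)"
proof -
  note [measurable] = site_history
  have "{w \<in> space (history M X n). P (site X n i w) (site X n j w)} \<in> sets (history M X n)"
    by measurable
  then show ?thesis by simp
qed

lemma cluster_history: "cluster n a b \<in> sets (history M X n)"
proof -
  note [measurable] = site_history
  have "{w \<in> space (history M X n). \<forall>j. site X n j w = indicator {a..<b} j} \<in> sets (history M X n)"
    by measurable
  then show ?thesis by (simp add: cluster_def)
qed

lemma history_sets: "B \<in> sets (history M X n) \<Longrightarrow> B \<in> sets M"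
  using subalgebra_history[of n] by (auto simp: subalgebra_def)

section \<open>One-step probabilities on events of the history\<close>

lemma prob_Int_of_cond_prob:
  assumes A: "A \<in> sets M" and B: "B \<in> sets (history M X n)"
    and c: "AE w in M. w \<in> B \<longrightarrow> cond_prob_alg M (history M X n) A w = c"
  shows "prob (B \<inter> A) = c * prob B"
proof -
  interpret finite_measure_subalgebra M "history M X n"
    by unfold_locales (rule subalgebra_history)
  have BM: "B \<in> sets M" using B by (rule history_sets)
  \<comment> \<open>The averaging property of conditional expectation over \<open>B\<close>,
    available because \<open>B\<close> lies in the history, replaces the indicator of
    \<open>A\<close> by its conditional probability, which is almost surely \<open>c\<close> on
    \<open>B\<close>.\<close>
  have "prob (B \<inter> A) = (\<integral>w\<in>B. indicator A w \<partial>M)"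
    using A BM by (simp add: set_lebesgue_integral_def indicator_inter_arith[symmetric]
        sets.Int_space_eq2)
  also have "\<dots> = (\<integral>w\<in>B. cond_prob_alg M (history M X n) A w \<partial>M)"
    using A B by (intro real_cond_exp_intA) (auto simp: integrable_real_indicator emeasure_eq_measure)
  also have "\<dots> = (\<integral>w\<in>B. c \<partial>M)"
    unfolding set_lebesgue_integral_def
    by (rule integral_cong_AE) (use c BM borel_measurable_cond_exp2 in \<open>auto simp: indicator_def elim!: eventually_mono\<close>)
  also have "\<dots> = c * prob B"
    using BM by (simp add: set_lebesgue_integral_def sets.Int_space_eq2)
  finally show ?thesis .
qed

definition alive :: "nat \<Rightarrow> int \<Rightarrow> 'w set" where
  "alive n j = {w \<in> space M. site X n j w = 1}"

lemma sets_alive [measurable]: "alive n j \<in> sets M"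
  using history_sets[OF sets_history_sites[of "\<lambda>x y. x = 1" n j j]] by (simp add: alive_def)

lemma prob_alive:
  assumes j: "0 \<le> j" "j \<le> int n + 1" and B: "B \<in> sets (history M X n)"
    and c: "\<And>w. w \<in> B \<Longrightarrow> fire_prob \<alpha> \<beta> \<gamma> (site X n (j - 1) w) (site X n j w) = c"
  shows "prob (B \<inter> alive (n + 1) j) = c * prob B"
proof (rule prob_Int_of_cond_prob[OF sets_alive B])
  show "AE w in M. w \<in> B \<longrightarrow> cond_prob_alg M (history M X n) (alive (n + 1) j) w = c"
    using cond_law[OF j] unfolding alive_def by eventually_elim (simp add: c)
qed

text \<open>Conditional independence, applied to the index set \<open>{i, j}\<close> and the value
  set \<open>{1}\<close>, makes the conditional probability of both sites being 1 the product of the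
  two transition probabilities. It serves for the two random ends of a cluster.\<close>

lemma prob_alive_alive:
  assumes i: "0 \<le> i" "i \<le> int n + 1" and j: "0 \<le> j" "j \<le> int n + 1" and "i \<noteq> j"
    and B: "B \<in> sets (history M X n)"
    and c: "\<And>w. w \<in> B \<Longrightarrow> fire_prob \<alpha> \<beta> \<gamma> (site X n (i - 1) w) (site X n i w) = c"
    and d: "\<And>w. w \<in> B \<Longrightarrow> fire_prob \<alpha> \<beta> \<gamma> (site X n (j - 1) w) (site X n j w) = d"
  shows "prob (B \<inter> (alive (n + 1) i \<inter> alive (n + 1) j)) = c * d * prob B"
proof (rule prob_Int_of_cond_prob[OF _ B])
  have eq: "site X (n + 1) k -` {1} \<inter> space M = alive (n + 1) k" for k
    by (auto simp: alive_def)
  have "AE w in M. cond_prob_alg M (history M X n)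
          (\<Inter>k\<in>{i, j}. site X (n + 1) k -` {1} \<inter> space M) w
        = (\<Prod>k\<in>{i, j}. cond_prob_alg M (history M X n) (site X (n + 1) k -` {1} \<inter> space M) w)"
    using cond_indep[of n] i j unfolding cond_indep_vars_def
    by (elim conjE allE[of _ "{i, j}"] impE allE[of _ "\<lambda>_. {1}"]) auto
  then have "AE w in M. cond_prob_alg M (history M X n) (alive (n + 1) i \<inter> alive (n + 1) j) w
        = cond_prob_alg M (history M X n) (alive (n + 1) i) w
          * cond_prob_alg M (history M X n) (alive (n + 1) j) w"
    unfolding eq using \<open>i \<noteq> j\<close> by simp
  then show "AE w in M. w \<in> B \<longrightarrow>
      cond_prob_alg M (history M X n) (alive (n + 1) i \<inter> alive (n + 1) j) w = c * d"
    using cond_law[OF i] cond_law[OF j] unfolding alive_def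
    by eventually_elim (simp add: c d)
qed auto

section \<open>Almost sure evolution of the cluster\<close>

lemma AE_step:
  assumes "\<gamma> = 1"
  shows "AE w in M. \<forall>j.
    (site X n (j - 1) w = 0 \<and> site X n j w = 0 \<longrightarrow> site X (n + 1) j w = 0) \<and>
    (site X n (j - 1) w = 1 \<and> site X n j w = 1 \<longrightarrow> site X (n + 1) j w = 1)"
proof -
  have "AE w in M.
    (site X n (j - 1) w = 0 \<and> site X n j w = 0 \<longrightarrow> site X (n + 1) j w = 0) \<and>
    (site X n (j - 1) w = 1 \<and> site X n j w = 1 \<longrightarrow> site X (n + 1) j w = 1)" for j
  proof (cases "0 \<le> j \<and> j \<le> int n + 1")
    case True
    let ?B = "\<lambda>x. {w \<in> space M. site X n (j - 1) w = x \<and> site X n j w = x}"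
    have B: "?B x \<in> sets (history M X n)" for x
      by (rule sets_history_sites)
    have 0: "prob (?B 0 \<inter> alive (n + 1) j) = 0 * prob (?B 0)"
      by (rule prob_alive) (use True B in \<open>auto simp: fire_prob_def\<close>)
    \<comment> \<open>Here \<open>\<gamma> = 1\<close> enters: if both parents are 1, the site is 1
      with conditional probability 1, so the event that it fails is null.\<close>
    have "prob (?B 1 \<inter> alive (n + 1) j) = 1 * prob (?B 1)"
      by (rule prob_alive) (use True B assms in \<open>auto simp: fire_prob_def\<close>)
    then have 1: "prob (?B 1 - alive (n + 1) j) = 0"
      using history_sets[OF B] by (subst finite_measure_Diff') auto
    have "AE w in M. w \<notin> ?B 0 \<inter> alive (n + 1) j"
      using 0 history_sets[OF B] by (subst prob_eq_0[symmetric]) auto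
    moreover have "AE w in M. w \<notin> ?B 1 - alive (n + 1) j"
      using 1 history_sets[OF B] by (subst prob_eq_0[symmetric]) auto
    ultimately show ?thesis
      using AE_space
    proof eventually_elim
      case (elim w)
      then show ?case
        using site_range[of w "n + 1" j] by (auto simp: alive_def)
    qed
  next
    \<comment> \<open>Beyond row \<open>n + 1\<close> the new site is 0 and so is
      \<open>site X n j\<close>; the first implication holds trivially and the premise of the second
      fails.\<close>
    case False
    then show ?thesis
      by (auto simp: site_outside)
  qed
  \<comment> \<open>There are only countably many \<open>j\<close>, so the exceptional null sets can
    be united.\<close>
  then show ?thesis
    by (simp add: AE_all_countable)
qed

text \<open>The end sites \<open>a\<close> and \<open>b - 1\<close> of a nonempty cluster carry the
  value 1, which is impossible outside the row.\<close>

lemma cluster_bounds: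
  assumes "w \<in> cluster n a b" "a < b"
  shows "0 \<le> a" "b \<le> int n + 1"
proof -
  have "site X n a w = 1" "site X n (b - 1) w = 1"
    using assms by (auto simp: cluster_def)
  then show "0 \<le> a" "b \<le> int n + 1"
    using site_outside[of a n w] site_outside[of "b - 1" n w] by linarith+
qed

lemma row_sum_cluster:
  assumes "w \<in> cluster n a b"
  shows "row_sum X n w = nat (b - a)"
proof (cases "a < b")
  case True
  note bounds = cluster_bounds[OF assms True]
  have "row_sum X n w = (\<Sum>j\<in>{0..n}. indicator {nat a..<nat b} j)"
    unfolding row_sum_def
    by (rule sum.cong) (use assms bounds True in \<open>auto simp: cluster_def indicator_def\<close>)
  also have "\<dots> = card ({0..n} \<inter> {nat a..<nat b})"
    by (simp add: sum_indicator_eq_card)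
  also have "{0..n} \<inter> {nat a..<nat b} = {nat a..<nat b}"
    using bounds by auto
  finally show ?thesis
    using bounds True by (simp add: nat_diff_distrib)
next
  case False
  then show ?thesis
    using assms by (auto simp: cluster_def row_sum_def)
qed

text \<open>Sites strictly between \<open>a\<close> and \<open>b\<close> have parents (1,1) and are
  forced to 1; sites outside \<open>{a..b}\<close> have parents (0,0) and are forced to 0. Only
  \<open>a\<close> and \<open>b\<close> are left to chance: the left end stays at \<open>a\<close>
  or moves to \<open>a + 1\<close>, the right end stays at \<open>b\<close> or moves to
  \<open>b + 1\<close>. An empty cluster stays empty, represented by \<open>a..<a\<close>.\<close>

lemma AE_cluster_step:
  assumes "\<gamma> = 1"
  shows "AE w in M. \<forall>a b. w \<in> cluster n a b \<longrightarrow>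
    (if a < b then w \<in> cluster (n + 1) (a + 1 - int (site X (n + 1) a w)) (b + int (site X (n + 1) b w))
     else w \<in> cluster (n + 1) a a)"
  using AE_step[OF assms, of n] AE_space
proof eventually_elim
  case (elim w)
  show ?case
  proof (intro allI impI)
    fix a b
    assume w: "w \<in> cluster n a b"
    then have s: "site X n j w = indicator {a..<b} j" for j
      by (simp add: cluster_def)
    have out: "site X (n + 1) j w = 0" if "\<not> (a \<le> j \<and> j \<le> b \<and> a < b)" for j
      using elim(1)[rule_format, of j] s[of j] s[of "j - 1"] that by (auto simp: indicator_def)
    have ins: "site X (n + 1) j w = 1" if "a < j" "j < b" for j
      using elim(1)[rule_format, of j] s[of j] s[of "j - 1"] that by (auto simp: indicator_def)
    show "if a < b then w \<in> cluster (n + 1) (a + 1 - int (site X (n + 1) a w)) (b + int (site X (n + 1) b w))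
     else w \<in> cluster (n + 1) a a"
    proof (cases "a < b")
      case True
      have "site X (n + 1) j w =
        indicator {a + 1 - int (site X (n + 1) a w)..<b + int (site X (n + 1) b w)} j" for j
      proof -
        consider "j = a" | "j = b" | "a < j" "j < b" | "j < a \<or> b < j" by linarith
        then show ?thesis
          using True out[of j] ins[of j] site_range[OF elim(2), of "n + 1" a]
            site_range[OF elim(2), of "n + 1" b]
          by cases (auto simp: indicator_def)
      qed
      then have "w \<in> cluster (n + 1) (a + 1 - int (site X (n + 1) a w)) (b + int (site X (n + 1) b w))"
        using elim(2) unfolding cluster_def by blast
      then show ?thesis
        using True by simp
    next
      case False
      then show ?thesis
        using out elim(2) by (simp add: cluster_def)
    qed
  qed
qed

lemma AE_ex_cluster:
  assumes "\<gamma> = 1"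
  shows "AE w in M. \<exists>a b. w \<in> cluster n a b"
proof (induction n)
  case 0
  show ?case
    using AE_space
  proof eventually_elim
    case (elim w)
    \<comment> \<open>Row 0 consists of the origin alone, whose value is 1.\<close>
    then have "w \<in> cluster 0 0 1"
      using origin by (auto simp: cluster_def site_def indicator_def)
    then show ?case by blast
  qed
next
  case (Suc n)
  with AE_cluster_step[OF assms, of n] show ?case
  proof eventually_elim
    case (elim w)
    then show ?case by (metis Suc_eq_plus1)
  qed
qed

text \<open>The new length is the difference of the new ends, that is, the \<open>b - a - 1\<close>
  forced interior sites plus the two random end sites.\<close>

lemma AE_row_sum_Suc:
  assumes "\<gamma> = 1"
  shows "AE w in M. \<forall>a b. w \<in> cluster n a b \<longrightarrow>
    row_sum X (n + 1) w = (if a < b then nat (b - a - 1) + site X (n + 1) a w + site X (n + 1) b w else 0)"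
  using AE_cluster_step[OF assms, of n] AE_space
proof eventually_elim
  case (elim w)
  show ?case
  proof (intro allI impI)
    fix a b
    assume "w \<in> cluster n a b"
    with elim(1) have *: "if a < b then w \<in> cluster (n + 1) (a + 1 - int (site X (n + 1) a w)) (b + int (site X (n + 1) b w))
     else w \<in> cluster (n + 1) a a" by blast
    show "row_sum X (n + 1) w = (if a < b then nat (b - a - 1) + site X (n + 1) a w + site X (n + 1) b w else 0)"
    proof (cases "a < b")
      case True
      then show ?thesis
        using row_sum_cluster[of w "n + 1"] * by (simp add: nat_eq_iff)
    next
      case False
      then show ?thesis
        using row_sum_cluster[of w "n + 1" a a] * by simp
    qed
  qed
qed

section \<open>Generating function of the row sum on one cluster\<close>

lemma row_sum_measurable [measurable]: "row_sum X n \<in> measurable M (count_space UNIV)"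
  unfolding row_sum_def[abs_def] using measurable_site by measurable

lemma integrable_power_row_sum:
  fixes r :: real
  assumes "0 \<le> r" "r \<le> 1"
  shows "integrable M (\<lambda>w. r ^ row_sum X n w)"
  by (rule integrable_const_bound[of _ 1]) (use assms in \<open>auto simp: power_le_one\<close>)

text \<open>Given the cluster, the row sum changes by \<open>- 1\<close> plus two independent
  Bernoulli variables: site \<open>a\<close> has parents (0,1) and parameter \<open>\<beta>\<close>,
  site \<open>b\<close> has parents (1,0) and parameter \<open>\<alpha>\<close>. The factor is the
  product of their generating functions, divided by \<open>r\<close> for the shift.\<close>

lemma integral_power_cluster:
  fixes r :: real
  assumes "\<gamma> = 1" and r: "0 < r" "r \<le> 1" and "a < b"
  shows "(\<integral>w. indicator (cluster n a b) w * r ^ row_sum X (n + 1) w \<partial>M)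
    = (1 - \<alpha> + \<alpha> * r) * (1 - \<beta> + \<beta> * r) / r
      * (\<integral>w. indicator (cluster n a b) w * r ^ row_sum X n w \<partial>M)"
proof (cases "cluster n a b = {}")
  case False
  then have bounds: "0 \<le> a" "b \<le> int n + 1"
    using cluster_bounds \<open>a < b\<close> by blast+
  let ?S = "cluster n a b" and ?A = "alive (n + 1) a" and ?B = "alive (n + 1) b"
  let ?l = "nat (b - a - 1)"
  have S: "?S \<in> sets M" by (rule history_sets[OF cluster_history])
  have A: "prob (?S \<inter> ?A) = \<beta> * prob ?S"
    by (rule prob_alive[OF _ _ cluster_history])
      (use bounds \<open>a < b\<close> in \<open>auto simp: cluster_def fire_prob_def\<close>)
  have B: "prob (?S \<inter> ?B) = \<alpha> * prob ?S"
    by (rule prob_alive[OF _ _ cluster_history])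
      (use bounds \<open>a < b\<close> in \<open>auto simp: cluster_def fire_prob_def\<close>)
  have AB: "prob (?S \<inter> (?A \<inter> ?B)) = \<beta> * \<alpha> * prob ?S"
    by (rule prob_alive_alive[OF _ _ _ _ _ cluster_history])
      (use bounds \<open>a < b\<close> in \<open>auto simp: cluster_def fire_prob_def\<close>)
  \<comment> \<open>For \<open>x\<close> in {0,1} one has \<open>r ^ x = 1 + (r - 1) * x\<close>.
    Multiplying this out for the two end sites leaves a combination of indicators, whose integrals
    are the probabilities just computed.\<close>
  have "(\<integral>w. indicator ?S w * r ^ row_sum X (n + 1) w \<partial>M)
    = (\<integral>w. r ^ ?l * (indicator ?S w + (r - 1) * indicator (?S \<inter> ?A) w
        + (r - 1) * indicator (?S \<inter> ?B) w + (r - 1)\<^sup>2 * indicator (?S \<inter> (?A \<inter> ?B)) w) \<partial>M)"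
  proof (rule integral_cong_AE)
    show "AE w in M. indicator ?S w * r ^ row_sum X (n + 1) w
      = r ^ ?l * (indicator ?S w + (r - 1) * indicator (?S \<inter> ?A) w
        + (r - 1) * indicator (?S \<inter> ?B) w + (r - 1)\<^sup>2 * indicator (?S \<inter> (?A \<inter> ?B)) w)"
      using AE_row_sum_Suc[OF \<open>\<gamma> = 1\<close>, of n] AE_space
    proof eventually_elim
      case (elim w)
      show ?case
      proof (cases "w \<in> ?S")
        case True
        then have "row_sum X (n + 1) w = ?l + site X (n + 1) a w + site X (n + 1) b w"
          using elim(1) \<open>a < b\<close> by simp
        then show ?thesis
          using True site_range[OF elim(2), of "n + 1" a] site_range[OF elim(2), of "n + 1" b] elim(2)
          by (auto simp: alive_def indicator_def power_add power2_eq_square algebra_simps)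
      qed simp
    qed
  qed (use S in measurable)
  also have "\<dots> = r ^ ?l * (prob ?S + (r - 1) * prob (?S \<inter> ?A)
        + (r - 1) * prob (?S \<inter> ?B) + (r - 1)\<^sup>2 * prob (?S \<inter> (?A \<inter> ?B)))"
    using S by (simp add: sets.Int_space_eq2 sets.sets_into_space integrable_real_indicator emeasure_eq_measure)
  also have "\<dots> = r ^ ?l * ((1 - \<alpha> + \<alpha> * r) * (1 - \<beta> + \<beta> * r)) * prob ?S"
    unfolding A B AB by (simp add: power2_eq_square algebra_simps)
  also have "r ^ ?l = r ^ nat (b - a) / r"
  proof -
    have "nat (b - a) = Suc ?l" using \<open>a < b\<close> by simp
    then show ?thesis using r by simp
  qed
  finally have L: "(\<integral>w. indicator ?S w * r ^ row_sum X (n + 1) w \<partial>M)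
    = r ^ nat (b - a) / r * ((1 - \<alpha> + \<alpha> * r) * (1 - \<beta> + \<beta> * r)) * prob ?S" .
  have "(\<integral>w. indicator ?S w * r ^ row_sum X n w \<partial>M) = (\<integral>w. r ^ nat (b - a) * indicator ?S w \<partial>M)"
    by (rule Bochner_Integration.integral_cong) (auto simp: indicator_def row_sum_cluster)
  also have "\<dots> = r ^ nat (b - a) * prob ?S"
    using S by (simp add: sets.Int_space_eq2)
  finally show ?thesis
    unfolding L by simp
qed simp

section \<open>Decomposition of expectations by clusters\<close>

lemma cluster_eqD:
  assumes "w \<in> cluster n a b" "w \<in> cluster n a' b'" "a < b" "a' < b'"
  shows "a = a' \<and> b = b'"
proof -
  have "indicator {a..<b} j = (indicator {a'..<b'} j :: nat)" for j
    using assms(1,2) by (simp add: cluster_def)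
  then have "j \<in> {a..<b} \<longleftrightarrow> j \<in> {a'..<b'}" for j
    by (metis indicator_eq_1_iff)
  then have "{a..<b} = {a'..<b'}" by blast
  then show ?thesis using assms(3,4) by (simp add: atLeastLessThan_eq_iff)
qed

text \<open>A pointwise partition of unity multiplied by the number \<open>f\<close>. A nonempty
  cluster has unique endpoints, so exactly one summand survives and the row sum is positive; an
  empty one makes all summands vanish and leaves the first term.\<close>

lemma sum_clusters_eq:
  fixes f :: real
  assumes "w \<in> cluster n a0 b0"
  shows "f = indicator {w \<in> space M. row_sum X n w = 0} w * f
    + (\<Sum>(a, b) \<in> {(a, b). 0 \<le> a \<and> a < b \<and> b \<le> int n + 1}. indicator (cluster n a b) w * f)"
proof -
  let ?I = "{(a, b). 0 \<le> a \<and> a < b \<and> b \<le> int n + 1}"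
  have fin: "finite ?I"
    by (rule finite_subset[of _ "{0..int n + 1} \<times> {0..int n + 1}"]) auto
  have w: "w \<in> space M" using assms by (simp add: cluster_def)
  show ?thesis
  proof (cases "a0 < b0")
    case True
    have "(\<Sum>(a, b)\<in>?I. indicator (cluster n a b) w * f)
        = (\<Sum>p\<in>?I. if p = (a0, b0) then f else 0)"
    proof (rule sum.cong[OF refl], clarify)
      fix a b assume "0 \<le> a" "a < b" "b \<le> int n + 1"
      then have "w \<in> cluster n a b \<longleftrightarrow> (a, b) = (a0, b0)"
        using assms True cluster_eqD[OF assms, of a b] by blast
      then show "indicator (cluster n a b) w * f = (if (a, b) = (a0, b0) then f else 0)"
        using assms by (cases "(a, b) = (a0, b0)") auto
    qed
    also have "\<dots> = f"
      using fin cluster_bounds[OF assms True] True by simp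
    finally show ?thesis
      using row_sum_cluster[OF assms] True by simp
  next
    case False
    have "indicator (cluster n a b) w = (0 :: real)" if "a < b" for a b
      using that row_sum_cluster[of w n a b] row_sum_cluster[OF assms] False
      by (auto simp: indicator_def)
    then have "(\<Sum>(a, b)\<in>?I. indicator (cluster n a b) w * f) = 0"
      by (intro sum.neutral) auto
    then show ?thesis
      using w False row_sum_cluster[OF assms] by simp
  qed
qed

text \<open>Almost every point lies in some cluster, so the pointwise identity can be integrated.
  The index set of pairs is finite, which permits exchanging sum and integral.\<close>

lemma integral_split:
  fixes f :: "'w \<Rightarrow> real"
  assumes "\<gamma> = 1" and f: "integrable M f"
  shows "(\<integral>w. f w \<partial>M) = (\<integral>w. indicator {w \<in> space M. row_sum X n w = 0} w * f w \<partial>M)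
    + (\<Sum>(a, b) \<in> {(a, b). 0 \<le> a \<and> a < b \<and> b \<le> int n + 1}.
        \<integral>w. indicator (cluster n a b) w * f w \<partial>M)"
proof -
  let ?I = "{(a, b). 0 \<le> a \<and> a < b \<and> b \<le> int n + 1}"
  have S: "cluster n a b \<in> sets M" for a b by (rule history_sets[OF cluster_history])
  have Z: "{w \<in> space M. row_sum X n w = 0} \<in> sets M" by measurable
  have int: "integrable M (\<lambda>w. indicator A w * f w)" if "A \<in> sets M" for A
    using integrable_mult_indicator[OF that f] by simp
  have [measurable]: "f \<in> borel_measurable M" using f by simp
  have "(\<integral>w. f w \<partial>M) = (\<integral>w. indicator {w \<in> space M. row_sum X n w = 0} w * f w
      + (\<Sum>(a, b)\<in>?I. indicator (cluster n a b) w * f w) \<partial>M)"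
  proof (rule integral_cong_AE)
    show "AE w in M. f w = indicator {w \<in> space M. row_sum X n w = 0} w * f w
      + (\<Sum>(a, b)\<in>?I. indicator (cluster n a b) w * f w)"
      using AE_ex_cluster[OF \<open>\<gamma> = 1\<close>, of n]
      by eventually_elim (use sum_clusters_eq in blast)
  qed (use S Z in \<open>auto simp: case_prod_beta\<close>)
  also have "\<dots> = (\<integral>w. indicator {w \<in> space M. row_sum X n w = 0} w * f w \<partial>M)
      + (\<integral>w. (\<Sum>(a, b)\<in>?I. indicator (cluster n a b) w * f w) \<partial>M)"
    by (intro Bochner_Integration.integral_add int Z Bochner_Integration.integrable_sum)
      (auto intro: int S)
  also have "(\<integral>w. (\<Sum>(a, b)\<in>?I. indicator (cluster n a b) w * f w) \<partial>M)
      = (\<Sum>(a, b)\<in>?I. \<integral>w. indicator (cluster n a b) w * f w \<partial>M)"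
    unfolding case_prod_beta by (intro Bochner_Integration.integral_sum int S)
  finally show ?thesis .
qed

section \<open>Extinction and the one-step recursion\<close>

definition extinct :: "nat \<Rightarrow> real" where
  "extinct n = prob {w \<in> space M. row_sum X n w = 0}"

lemma AE_extinct_Suc:
  assumes "\<gamma> = 1"
  shows "AE w in M. row_sum X n w = 0 \<longrightarrow> row_sum X (n + 1) w = 0"
  using AE_row_sum_Suc[OF assms, of n] AE_ex_cluster[OF assms, of n]
proof eventually_elim
  case (elim w)
  then obtain a b where ab: "w \<in> cluster n a b" by blast
  then show ?case
    using elim(1) row_sum_cluster[OF ab] by auto
qed

lemma extinct_Suc_ge:
  assumes "\<gamma> = 1"
  shows "extinct n \<le> extinct (Suc n)"
  unfolding extinct_def
proof (rule finite_measure_mono_AE)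
  show "AE w in M. w \<in> {w \<in> space M. row_sum X n w = 0} \<longrightarrow> w \<in> {w \<in> space M. row_sum X (Suc n) w = 0}"
    using AE_extinct_Suc[OF assms, of n] by eventually_elim simp
qed measurable

text \<open>Both sides concern the event that row \<open>n\<close> is alive. On its complement both
  row sums are almost surely 0 and both powers are 1, contributing \<open>extinct n\<close> to each
  expectation; hence \<open>extinct n\<close>, not \<open>extinct (Suc n)\<close>, is subtracted on
  the left. On every nonempty cluster the factor is the same.\<close>

lemma expectation_power_Suc:
  fixes r :: real
  assumes "\<gamma> = 1" and r: "0 < r" "r \<le> 1"
  shows "expectation (\<lambda>w. r ^ row_sum X (Suc n) w) - extinct n
    = (1 - \<alpha> + \<alpha> * r) * (1 - \<beta> + \<beta> * r) / r
      * (expectation (\<lambda>w. r ^ row_sum X n w) - extinct n)"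
proof -
  let ?Z = "{w \<in> space M. row_sum X n w = 0}"
  let ?I = "{(a, b). 0 \<le> a \<and> a < b \<and> b \<le> int n + 1}"
  have Z[measurable]: "?Z \<in> sets M" by measurable
  have P: "(\<integral>w. indicator ?Z w \<partial>M) = extinct n"
    by (simp add: extinct_def sets.Int_space_eq2)
  have "(\<integral>w. indicator ?Z w * r ^ row_sum X (n + 1) w \<partial>M) = (\<integral>w. indicator ?Z w \<partial>M)"
  proof (rule integral_cong_AE)
    show "AE w in M. indicator ?Z w * r ^ row_sum X (n + 1) w = indicator ?Z w"
      using AE_extinct_Suc[OF assms(1), of n] by eventually_elim (auto split: split_indicator)
  qed measurable
  moreover have "(\<integral>w. indicator ?Z w * r ^ row_sum X n w \<partial>M) = (\<integral>w. indicator ?Z w \<partial>M)"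
    by (rule Bochner_Integration.integral_cong) (auto split: split_indicator)
  moreover have "(\<Sum>(a, b)\<in>?I. \<integral>w. indicator (cluster n a b) w * r ^ row_sum X (n + 1) w \<partial>M)
     = (1 - \<alpha> + \<alpha> * r) * (1 - \<beta> + \<beta> * r) / r *
       (\<Sum>(a, b)\<in>?I. \<integral>w. indicator (cluster n a b) w * r ^ row_sum X n w \<partial>M)"
    unfolding sum_distrib_left
    by (rule sum.cong) (auto simp: integral_power_cluster[OF assms, simplified])
  ultimately show ?thesis
    using integral_split[OF assms(1) integrable_power_row_sum[of r "n + 1"], of n]
      integral_split[OF assms(1) integrable_power_row_sum[of r n], of n] r P
    by simp
qed

section \<open>Initial values and the limit of the extinction probability\<close>

lemma extinct_0: "extinct 0 = 0" and expectation_power_0: "expectation (\<lambda>w. r ^ row_sum X 0 w) = r" for r :: real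
proof -
  have *: "row_sum X 0 w = 1" if "w \<in> space M" for w
    using origin[OF that] by (simp add: row_sum_def site_def)
  then have "{w \<in> space M. row_sum X 0 w = 0} = {}" by auto
  then show "extinct 0 = 0" by (simp only: extinct_def measure_empty)
  have "expectation (\<lambda>w. r ^ row_sum X 0 w) = expectation (\<lambda>w. r)" for r :: real
    by (rule Bochner_Integration.integral_cong) (simp_all add: *)
  then show "expectation (\<lambda>w. r ^ row_sum X 0 w) = r" for r :: real by (simp add: prob_space)
qed

text \<open>On extinction the power is \<open>r ^ 0 = 1\<close>, even for \<open>r = 0\<close>;
  elsewhere it is nonnegative.\<close>

lemma extinct_le_expectation_power:
  fixes r :: real
  assumes "0 \<le> r" "r \<le> 1"
  shows "extinct n \<le> expectation (\<lambda>w. r ^ row_sum X n w)"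
proof -
  have "extinct n = (\<integral>w. indicator {w \<in> space M. row_sum X n w = 0} w \<partial>M)"
    by (simp add: extinct_def sets.Int_space_eq2)
  also have "\<dots> \<le> expectation (\<lambda>w. r ^ row_sum X n w)"
    by (rule integral_mono[OF _ integrable_power_row_sum[OF assms]])
      (use assms in \<open>auto simp: integrable_real_indicator emeasure_eq_measure split: split_indicator\<close>)
  finally show ?thesis .
qed

text \<open>The gap \<open>\<rho> - extinct n\<close> is squeezed between 0 and a geometric sequence
  of ratio \<open>\<phi> r\<close>, for a point \<open>r\<close> between \<open>\<rho>\<close> and
  1.\<close>

lemma extinct_tendsto:
  assumes "\<gamma> = 1" and "\<alpha> < 1" "\<beta> < 1" "\<alpha> + \<beta> > 1"
  shows "extinct \<longlonglongrightarrow> (1 - \<alpha>) * (1 - \<beta>) / (\<alpha> * \<beta>)"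
proof -
  define \<rho> where "\<rho> = (1 - \<alpha>) * (1 - \<beta>) / (\<alpha> * \<beta>)"
  define \<phi> where "\<phi> r = (1 - \<alpha> + \<alpha> * r) * (1 - \<beta> + \<beta> * r) / r" for r :: real
  define e where "e r n = expectation (\<lambda>w. r ^ row_sum X n w)" for r :: real and n
  have pos: "0 < \<alpha>" "0 < \<beta>" using assms by auto
  then have p: "0 < \<alpha> * \<beta>" by simp
  have q: "\<alpha> * \<beta> * \<rho> = (1 - \<alpha>) * (1 - \<beta>)"
    using pos by (simp add: \<rho>_def)
  \<comment> \<open>Expanding the left side gives
    \<open>1 - \<alpha> - \<beta> + \<alpha> * \<beta>\<close>, so this is exactly
    \<open>\<alpha> + \<beta> > 1\<close>.\<close>
  have "(1 - \<alpha>) * (1 - \<beta>) < \<alpha> * \<beta>"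
    using assms by (simp add: algebra_simps)
  then have \<rho>: "0 < \<rho>" "\<rho> < 1"
    using p assms by (auto simp: \<rho>_def divide_less_eq)
  \<comment> \<open>The numerator minus \<open>r\<close> is a quadratic with roots 1 and
    \<open>\<rho>\<close>; this form shows \<open>\<phi> \<rho> = 1\<close> and
    \<open>\<phi> r < 1\<close> strictly between the roots.\<close>
  have \<phi>: "\<phi> r = 1 + \<alpha> * \<beta> * (r - 1) * (r - \<rho>) / r" if "0 < r" for r
  proof -
    have "(1 - \<alpha> + \<alpha> * r) * (1 - \<beta> + \<beta> * r)
        = r + \<alpha> * \<beta> * r\<^sup>2 - (\<alpha> * \<beta> + (1 - \<alpha>) * (1 - \<beta>)) * r + (1 - \<alpha>) * (1 - \<beta>)"
      by (simp add: power2_eq_square algebra_simps)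
    also have "\<dots> = r + \<alpha> * \<beta> * (r - 1) * (r - \<rho>)"
      unfolding q[symmetric] by (simp add: power2_eq_square algebra_simps)
    finally show ?thesis
      using that by (simp add: \<phi>_def add_divide_distrib)
  qed
  have step: "e r (Suc n) - extinct n = \<phi> r * (e r n - extinct n)" if "0 < r" "r \<le> 1" for r n
    unfolding e_def \<phi>_def using expectation_power_Suc[OF assms(1) that] .
  have e_\<rho>: "e \<rho> n = \<rho>" for n
    using step[of \<rho>] \<rho> by (induction n) (auto simp: \<phi> e_def expectation_power_0)
  \<comment> \<open>What follows relies on \<open>\<rho> < r < 1\<close>; the square root is the
    point where \<open>\<phi>\<close> is smallest on the positive axis.\<close>
  define r where "r = sqrt \<rho>"
  have r: "0 < r" "r < 1" "\<rho> < r"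
    using \<rho> by (auto simp: r_def real_less_rsqrt power2_eq_square)
  have \<phi>1: "\<phi> r < 1"
    using r p by (auto simp: \<phi> divide_less_0_iff mult_less_0_iff)
  have \<phi>0: "0 \<le> \<phi> r"
    unfolding \<phi>_def using r pos assms by simp
  have bound: "e r n - extinct n \<le> \<phi> r ^ n * r" for n
  proof (induction n)
    case 0
    then show ?case by (simp add: e_def expectation_power_0 extinct_0)
  next
    case (Suc n)
    \<comment> \<open>The recursion subtracts \<open>extinct n\<close>; passing to the larger
      \<open>extinct (Suc n)\<close> only lowers the left side.\<close>
    have "e r (Suc n) - extinct (Suc n) \<le> \<phi> r * (e r n - extinct n)"
      using step[of r n] r extinct_Suc_ge[OF assms(1), of n] by simp
    also have "\<dots> \<le> \<phi> r * (\<phi> r ^ n * r)"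
      using Suc \<phi>0 by (rule mult_left_mono)
    finally show ?case by simp
  qed
  have mono: "e \<rho> n \<le> e r n" for n
    unfolding e_def using \<rho> r
    by (intro integral_mono integrable_power_row_sum power_mono) auto
  have lim: "(\<lambda>n. \<phi> r ^ n * r) \<longlonglongrightarrow> 0"
    using \<phi>0 \<phi>1 by (intro tendsto_mult_left_zero LIMSEQ_power_zero) simp
  have "(\<lambda>n. \<rho> - extinct n) \<longlonglongrightarrow> 0"
  proof (rule tendsto_sandwich[OF _ _ tendsto_const lim])
    show "\<forall>\<^sub>F n in sequentially. 0 \<le> \<rho> - extinct n"
      using extinct_le_expectation_power[of \<rho>] \<rho> e_\<rho> by (simp add: e_def)
    \<comment> \<open>Since \<open>\<rho> = e \<rho> n \<le> e r n\<close>, the geometric bound for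
      \<open>r\<close> controls the gap for \<open>\<rho>\<close>.\<close>
    show "\<forall>\<^sub>F n in sequentially. \<rho> - extinct n \<le> \<phi> r ^ n * r"
      by (intro always_eventually allI order.trans[OF _ bound]) (use mono e_\<rho> in simp)
  qed
  from tendsto_diff[OF tendsto_const[of \<rho>] this] show ?thesis
    by (simp add: \<rho>_def)
qed

end

text \<open>Because \<open>lim\<close> is a total operator, convergence is asserted next to the
  bound; both follow from the exact limit in \<open>extinct_tendsto\<close>.\<close>

theorem theorem2:
  fixes M :: "'w measure" and X :: "nat \<Rightarrow> nat \<Rightarrow> 'w \<Rightarrow> nat" and \<alpha> \<beta> :: real
  assumes "\<alpha> \<in> {0..1}" and "\<beta> \<in> {0..1}"
    and "\<alpha> \<noteq> 1" and "\<beta> \<noteq> 1" and "\<alpha> + \<beta> > 1"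
    and "forest_fire M X \<alpha> \<beta> 1"
  shows "convergent (\<lambda>n. measure M {w \<in> space M. row_sum X n w = 0}) \<and>
         lim (\<lambda>n. measure M {w \<in> space M. row_sum X n w = 0})
           \<ge> (1 - \<alpha>) * (1 - \<beta>) / (\<alpha> * \<beta>)"
proof -
  interpret forest_fire M X \<alpha> \<beta> 1 by fact
  have "(\<lambda>n. measure M {w \<in> space M. row_sum X n w = 0}) \<longlonglongrightarrow> (1 - \<alpha>) * (1 - \<beta>) / (\<alpha> * \<beta>)"
    using extinct_tendsto assms(1-5) unfolding extinct_def[abs_def] by simp
  then show ?thesis
    by (simp add: limI convergentI)
qed

end
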